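(* For each integer $n\geq 1$ and each subgroup $G\leq S_n$, there exists an infinite word $w$ (over some finite alphabet) whose symmetry group of order $n$ satisfies $G_n(w)=G$.
   Context: An alphabet is a finite set of letters; an infinite word is a one-sided sequence $w=w_1w_2\cdots$ of letters. $F_n(w)$ denotes the set of factors (contiguous blocks) of length $n$ of $w$. A permutation $g\in S_n$ of $\{1,\dots,n\}$ acts on a word $u=u_1\cdots u_n$ by $g(u)=u_{g^{-1}(1)}u_{g^{-1}(2)}\cdots u_{g^{-1}(n)}$. The symmetry group of order $n$ of $w$ is $G_n(w)=\{\pi\in S_n \mid \pi(x)\in F_n(w)\text{ for each }x\in F_n(w)\}$. The alphabet is not fixed in advance (it may depend on $n$ and $G$). *)

theory Defs
  imports "HOL-Algebra.Sym_Groups"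
begin

text \<open>An infinite word $w_1 w_2 \cdots$ is a function on \<^typ>\<open>nat\<close>, the letter $w_{i+1}$
  being \<open>w i\<close>. Finite words are lists.\<close>

definition factors :: "nat \<Rightarrow> (nat \<Rightarrow> 'a) \<Rightarrow> 'a list set" where
  "factors n w = {map w [k..<k + n] | k. True}"

text \<open>Permutations act on the positions $1, \ldots, n$, as in \<^const>\<open>sym_group\<close>, while list
  indices start at 0.\<close>

definition perm_word :: "(nat \<Rightarrow> nat) \<Rightarrow> 'a list \<Rightarrow> 'a list" where
  "perm_word g u = map (\<lambda>i. u ! (inv' g i - 1)) [1..<Suc (length u)]"

definition symmetry_group :: "nat \<Rightarrow> (nat \<Rightarrow> 'a) \<Rightarrow> (nat \<Rightarrow> nat) set" where
  "symmetry_group n w =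
     {\<pi> \<in> carrier (sym_group n). \<forall>x \<in> factors n w. perm_word \<pi> x \<in> factors n w}"

end

theory Submission
  imports Defs "HOL-Library.Countable_Set"
begin

text \<open>Take the letters $0, 1, \ldots, n$ and let $X$ consist of all words of length $n$ that contain
  $0$ together with the orbit of $12 \cdots n$ under $G$. Writing the words of $X$ one after the
  other, separated by the letter $0$, gives an infinite word whose factors of length $n$ are exactly
  the elements of $X$, since a factor that is not one of the listed words meets a separator. A
  permutation maps words containing $0$ to such words, so it preserves $X$ iff it preserves the
  orbit, that is, iff it belongs to $G$.\<close>

lemma ex_word_with_factors:
  fixes X :: "'a list set"
  assumes "countable X" "X \<noteq> {}"
    and X_sub: "X \<subseteq> {u \<in> lists A. length u = n}"
    and z: "z \<in> A"
    and zX: "\<And>u. \<lbrakk>u \<in> lists A; length u = n; z \<in> set u\<rbrakk> \<Longrightarrow> u \<in> X"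
  shows "\<exists>w. range w \<subseteq> A \<and> factors n w = X"
proof -
  \<comment> \<open>The enumeration may repeat words, so a finite \<open>X\<close> also supplies
    infinitely many blocks.\<close>
  obtain f :: "nat \<Rightarrow> 'a list" where f: "range f = X"
    using range_from_nat_into assms(1,2) by metis
  have len: "length (f i) = n" and letters: "set (f i) \<subseteq> A" for i
    using X_sub f by (auto simp: subset_iff lists_eq_set)
  \<comment> \<open>Blocks have length \<open>Suc n\<close>: the quotient of \<open>k\<close>
    selects the block, the remainder the offset in it, and offset \<open>n\<close> is the separator
    \<open>z\<close>.\<close>
  define w where "w k = (f (k div Suc n) @ [z]) ! (k mod Suc n)" for k
  have w_range: "range w \<subseteq> A"
  proof clarify
    fix k
    have "w k \<in> set (f (k div Suc n) @ [z])"
      unfolding w_def by (rule nth_mem) (simp add: len)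
    then show "w k \<in> A"
      using z letters by auto
  qed
  have block: "map w [i * Suc n..<i * Suc n + n] = f i" for i
  proof (rule nth_equalityI)
    fix j assume "j < length (map w [i * Suc n..<i * Suc n + n])"
    then have "j < n" by simp
    then have "(i * Suc n + j) div Suc n = i" "(i * Suc n + j) mod Suc n = j"
      by (simp_all del: mult_Suc_right)
    with \<open>j < n\<close> show "map w [i * Suc n..<i * Suc n + n] ! j = f i ! j"
      by (simp add: w_def nth_append len del: mult_Suc_right)
  qed (simp add: len)
  have "map w [k..<k + n] \<in> X" for k
  proof (cases "k mod Suc n = 0")
    case True
    then have "k = k div Suc n * Suc n"
      by (metis add.right_neutral div_mult_mod_eq)
    then show ?thesis
      using block[of "k div Suc n"] f by auto
  next
    case False
    \<comment> \<open>\<open>p\<close> is the separator closing the block that contains position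
      \<open>k\<close>. The offset of \<open>k\<close> is at least 1 here, so at most
      \<open>n - 1\<close> steps lead from \<open>k\<close> to \<open>p\<close>, and the window of
      length \<open>n\<close> reaches it.\<close>
    define p where "p = k div Suc n * Suc n + n"
    have k: "k = k div Suc n * Suc n + k mod Suc n"
      by (rule div_mult_mod_eq[symmetric])
    moreover have "k mod Suc n < Suc n" by simp
    ultimately have "k \<le> p" "p < k + n"
      using False unfolding p_def by linarith+
    moreover have "p div Suc n = k div Suc n" "p mod Suc n = n"
      unfolding p_def by (simp_all del: mult_Suc_right)
    then have "w p = z"
      by (simp add: w_def nth_append len)
    ultimately have "z \<in> set (map w [k..<k + n])"
      by force
    then show ?thesis
      using w_range by (intro zX) (auto dest: subsetD[OF _ rangeI])
  qed
  moreover have "f i \<in> factors n w" for i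
    unfolding factors_def using block[of i] by (metis (mono_tags, lifting) mem_Collect_eq)
  ultimately have "factors n w = X"
    using f by (auto simp: factors_def)
  with w_range show ?thesis by blast
qed

lemma length_perm_word [simp]: "length (perm_word g u) = length u"
  by (simp add: perm_word_def del: upt_Suc)

text \<open>Permuting positions only rearranges letters. Hence whether 0 occurs in a word is
  invariant under the action.\<close>

lemma set_perm_word:
  assumes "g permutes {1..length u}"
  shows "set (perm_word g u) = set u"
proof -
  have upt: "{1..<Suc (length u)} = {1..length u}" by auto
  have "set (perm_word g u) = (\<lambda>i. u ! (i - 1)) ` inv' g ` {1..length u}"
    unfolding perm_word_def set_map set_upt upt image_image ..
  also have "inv' g ` {1..length u} = {1..length u}"
    by (rule permutes_image[OF permutes_inv[OF assms]])
  also have "{1..length u} = Suc ` {0..<length u}"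
    by auto
  also have "(\<lambda>i. u ! (i - 1)) ` \<dots> = set u"
    using nth_image[of "length u" u] by (simp only: image_image diff_Suc_1 take_all order_refl)
  finally show ?thesis .
qed

lemma nth_perm_word:
  assumes "i \<in> {1..length u}"
  shows "perm_word g u ! (i - 1) = u ! (inv' g i - 1)"
proof -
  from assms have "i - 1 < length u" "Suc (i - 1) = i" by auto
  then show ?thesis by (simp add: perm_word_def del: upt_Suc)
qed

text \<open>The inverse in \<open>perm_word\<close> makes this a left action: inverting a
  composition reverses its order, and so does looking up positions successively.\<close>

lemma perm_word_comp:
  assumes "g permutes {1..length u}" "h permutes {1..length u}"
  shows "perm_word (g \<circ> h) u = perm_word g (perm_word h u)"
proof -
  have "inv' (g \<circ> h) = inv' h \<circ> inv' g"
    using assms by (simp add: o_inv_distrib permutes_bij)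
  moreover have "perm_word h u ! (inv' g i - 1) = u ! (inv' h (inv' g i) - 1)"
    if "i \<in> {1..length u}" for i
    using permutes_in_image[OF permutes_inv[OF assms(1)]] that by (intro nth_perm_word) blast
  ultimately show ?thesis
    by (auto simp: perm_word_def[of g] perm_word_def[of "g \<circ> h"] simp del: upt_Suc)
qed

text \<open>In this word the letter at position \<open>i\<close>, counted from 1, is
  \<open>i\<close> itself, so the lookup returns the position.\<close>

lemma perm_word_upt:
  assumes "g permutes {1..n}"
  shows "perm_word g [1..<Suc n] = map (inv' g) [1..<Suc n]"
proof -
  have "[1..<Suc n] ! (inv' g i - 1) = inv' g i" if "i \<in> {1..n}" for i
  proof -
    have "inv' g i \<in> {1..n}"
      using permutes_in_image[OF permutes_inv[OF assms]] that by blast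
    then show ?thesis
      by (subst nth_upt) auto
  qed
  then show ?thesis
    by (auto simp: perm_word_def simp del: upt_Suc)
qed

text \<open>The letters of the word are pairwise distinct, so its stabilizer is trivial and each
  word of its orbit comes from a single permutation. Outside \<open>{1..n}\<close> both inverses are
  the identity.\<close>

lemma perm_word_upt_inject:
  assumes g: "g permutes {1..n}" and h: "h permutes {1..n}"
    and eq: "perm_word g [1..<Suc n] = perm_word h [1..<Suc n]"
  shows "g = h"
proof -
  have "inv' g i = inv' h i" for i
  proof (cases "i \<in> {1..n}")
    case True
    then show ?thesis
      using eq unfolding perm_word_upt[OF g] perm_word_upt[OF h] map_eq_conv by (simp del: upt_Suc)
  next
    case False
    then show ?thesis
      using permutes_not_in[OF permutes_inv[OF g]] permutes_not_in[OF permutes_inv[OF h]] by simp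
  qed
  then have "inv' g = inv' h" by blast
  then show ?thesis
    using permutes_inv_inv[OF g] permutes_inv_inv[OF h] by metis
qed

theorem proposition2:
  fixes n :: nat and G :: "(nat \<Rightarrow> nat) set"
  assumes "n \<ge> 1" and "subgroup G (sym_group n)"
  shows "\<exists>w :: nat \<Rightarrow> nat. finite (range w) \<and> symmetry_group n w = G"
proof -
  let ?id = "[1..<Suc n]"
  define orbit where "orbit = (\<lambda>g. perm_word g ?id) ` G"
  define X where "X = {u \<in> lists {0..n}. length u = n \<and> 0 \<in> set u} \<union> orbit"
  have G: "g permutes {1..n}" if "g \<in> G" for g
    using subgroup.subset[OF assms(2)] that by (auto simp: sym_group_def)
  have id: "id \<in> G"
    using subgroup.one_closed[OF assms(2)] by (simp add: sym_group_def)
  have comp: "g \<circ> h \<in> G" if "g \<in> G" "h \<in> G" for g h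
    using subgroup.m_closed[OF assms(2) that] by (simp add: sym_group_def)
  have orbit_set: "set u = {1..n}" "length u = n" if "u \<in> orbit" for u
    using that set_perm_word[of _ ?id] G
    by (auto simp: orbit_def atLeastLessThanSuc_atLeastAtMost simp del: upt_Suc)
  have "X \<noteq> {}"
    using id by (auto simp: X_def orbit_def)
  moreover have "X \<subseteq> {u \<in> lists {0..n}. length u = n}"
    using orbit_set by (auto simp: X_def lists_eq_set)
  ultimately obtain w where w: "range w \<subseteq> {0..n}" "factors n w = X"
    using ex_word_with_factors[of X "{0..n}" n 0] by (auto simp: X_def)
  have "(\<forall>x \<in> X. perm_word \<pi> x \<in> X) \<longleftrightarrow> \<pi> \<in> G" if \<pi>: "\<pi> permutes {1..n}" for \<pi>
  proof
    assume *: "\<forall>x \<in> X. perm_word \<pi> x \<in> X"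
    \<comment> \<open>One test word suffices: \<open>?id\<close> lies in the orbit because
      \<open>id\<close> is in \<open>G\<close>. Its image under \<open>\<pi>\<close> avoids 0, so it
      can be in \<open>X\<close> only as a word of the orbit, and injectivity then identifies
      \<open>\<pi>\<close> with an element of \<open>G\<close>.\<close>
    have "?id = perm_word id ?id"
      by (subst perm_word_upt[OF permutes_id]) (simp del: upt_Suc)
    then have "?id \<in> orbit"
      unfolding orbit_def using id by (rule image_eqI)
    then have "?id \<in> X"
      unfolding X_def by (rule UnI2)
    then have "perm_word \<pi> ?id \<in> X"
      using * by blast
    moreover have "0 \<notin> set (perm_word \<pi> ?id)"
      using set_perm_word[of \<pi> ?id] \<pi> by (simp del: upt_Suc)
    ultimately obtain g where "g \<in> G" "perm_word \<pi> ?id = perm_word g ?id"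
      by (auto simp: X_def orbit_def)
    then show "\<pi> \<in> G"
      using perm_word_upt_inject[OF \<pi> G] by blast
  next
    assume "\<pi> \<in> G"
    \<comment> \<open>The two parts of \<open>X\<close> are preserved separately: words with 0 by
      any permutation, the orbit because \<open>G\<close> is closed under composition.\<close>
    have "perm_word \<pi> u \<in> X" if "u \<in> lists {0..n}" "length u = n" "0 \<in> set u" for u
      using that set_perm_word[of \<pi> u] \<pi> by (auto simp: X_def lists_eq_set)
    moreover have "perm_word \<pi> (perm_word g ?id) \<in> orbit" if "g \<in> G" for g
    proof -
      have "perm_word \<pi> (perm_word g ?id) = perm_word (\<pi> \<circ> g) ?id"
        using \<pi> G[OF that] by (intro perm_word_comp[symmetric]) (simp_all del: upt_Suc)
      then show ?thesis
        unfolding orbit_def using comp[OF \<open>\<pi> \<in> G\<close> that] by (rule image_eqI)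
    qed
    ultimately show "\<forall>x \<in> X. perm_word \<pi> x \<in> X"
      by (auto simp: X_def orbit_def simp del: upt_Suc)
  qed
  then have "symmetry_group n w = G"
    using G by (auto simp: symmetry_group_def w(2) sym_group_def)
  moreover have "finite (range w)"
    using w(1) finite_subset by blast
  ultimately show ?thesis by blast
qed

end
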